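(* Consider a semi-explicit pHDAE on $\mathcal X=\mathcal X_1\times\mathcal X_2\subseteq\mathbb R^{n_1}\times\mathbb R^{n_2}$ with coefficients $E=\mathrm{diag}(E_{11},0),J,R,B$, $z=(z_1,z_2)$, Hamiltonian $\mathcal H$ and specified Hamiltonian $\mathcal H_1\in C^1(\mathcal X_1,\mathbb R)$. Let $\overline\nabla\mathcal H_1$ be a discrete gradient of $\mathcal H_1$, and let $\overline E_{11},\overline z_2,\overline J,\overline R,\overline B$ be consistent approximations of $E_{11},z_2,J,R,B$, with $\overline J=-\overline J^\top$ and $\overline R=\overline R^\top\succeq0$ pointwise. Let $h>0$, and suppose that $x^k=(x_1^k,x_2^k),\,x^{k+1}=(x_1^{k+1},x_2^{k+1})\in\mathcal X$, $z_1^{k,k+1}\in\mathbb R^{n_1}$ and $u^{k,k+1},y^{k,k+1}\in\mathbb R^m$ satisfy, with all barred functions evaluated at $(x^k,x^{k+1})$ and $\zeta:=\begin{bmatrix}z_1^{k,k+1}\\ \overline z_2(x^k,x^{k+1})\end{bmatrix}$, $$\begin{bmatrix}\overline E_{11}&0\\ 0&0\end{bmatrix}\begin{bmatrix}x_1^{k+1}-x_1^k\\ x_2^{k+1}-x_2^k\end{bmatrix}=h(\overline J-\overline R)\zeta+h\overline B u^{k,k+1},\qquad y^{k,k+1}=\overline B^\top\zeta,\qquad \overline E_{11}^\top z_1^{k,k+1}=\overline\nabla\mathcal H_1(x_1^k,x_1^{k+1}).$$ Then $$\mathcal H(x^{k+1})-\mathcal H(x^k)=-h\,\zeta^\top\overline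 R(x^k,x^{k+1})\,\zeta+h\,(y^{k,k+1})^\top u^{k,k+1}\le h\,(y^{k,k+1})^\top u^{k,k+1}.$$
   Context: Gradients are column vectors. A semi-explicit pHDAE is a system $E(x)\dot x=(J(x)-R(x))z(x)+B(x)u$, $y=B(x)^\top z(x)$ with state $x=(x_1,x_2)\in\mathcal X=\mathcal X_1\times\mathcal X_2$, where $\mathcal X_1\subseteq\mathbb R^{n_1}$ is open, $\mathcal X_2\subseteq\mathbb R^{n_2}$ is open and convex, $n=n_1+n_2$, $E,J,R\in C(\mathcal X,\mathbb R^{n,n})$, $B\in C(\mathcal X,\mathbb R^{n,m})$, $z=(z_1,z_2)\in C(\mathcal X,\mathbb R^{n_1}\times\mathbb R^{n_2})$, $J=-J^\top$ and $R=R^\top\succeq0$ pointwise, $E=\mathrm{diag}(E_{11},0)$ with $E_{11}\in C(\mathcal X,\mathbb R^{n_1,n_1})$ pointwise invertible, and $E(x)^\top z(x)=\nabla\mathcal H(x)$ for all $x\in\mathcal X$, where $\mathcal H\in C^1(\mathcal X,\mathbb R)$ is the Hamiltonian. In this situation there is $\mathcal H_1\in C^1(\mathcal X_1,\mathbb R)$, the specified Hamiltonian, with $\mathcal H_1(x_1)=\mathcal H(x_1,x_2)$ and $\nabla\mathcal H_1(x_1)=\nabla_{x_1}\mathcal H(x_1,x_2)=E_{11}(x_1,x_2)^\top z_1(x_1,x_2)$ for all $(x_1,x_2)\in\mathcal X$. A discrete gradient of $f\in C^1(\mathcal Y,\mathbb R)$, $\mathcal Y\subseteq\mathbb R^d$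 open, is $\overline\nabla f\in C(\mathcal Y\times\mathcal Y,\mathbb R^d)$ with $\overline\nabla f(x,x')^\top(x'-x)=f(x')-f(x)$ for all $x,x'\in\mathcal Y$ and $\overline\nabla f(x,x)=\nabla f(x)$ for all $x\in\mathcal Y$. A continuous $\overline F$ on $\mathcal X\times\mathcal X$ is a consistent approximation of a continuous $F$ on $\mathcal X$ if $\overline F(x,x)=F(x)$ for all $x$. *)

theory Defs
  imports "HOL-Analysis.Analysis"
begin

text \<open>A point of \<open>\<real>\<^sup>n\<^sup>1 \<times> \<real>\<^sup>n\<^sup>2\<close> is a pair; it is identified with a column vector of
  length \<open>n = n1 + n2\<close>, indexed by the sum type, so that \<open>n \<times> n\<close> matrices can act on it.\<close>

definition stack :: "(real^'n1) \<times> (real^'n2) \<Rightarrow> real^('n1 + 'n2)" where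
  "stack p = (\<chi> i. case i of Inl a \<Rightarrow> fst p $ a | Inr b \<Rightarrow> snd p $ b)"

definition unstack :: "real^('n1 + 'n2) \<Rightarrow> (real^'n1) \<times> (real^'n2)" where
  "unstack v = (\<chi> a. v $ Inl a, \<chi> b. v $ Inr b)"

lemma unstack_stack [simp]: "unstack (stack p) = p"
  by (simp add: stack_def unstack_def prod_eq_iff vec_eq_iff)

lemma stack_unstack [simp]: "stack (unstack v) = v"
  by (auto simp: stack_def unstack_def vec_eq_iff split: sum.split)

definition block_diag ::
  "real^'n1^'n1 \<Rightarrow> real^'n2^'n2 \<Rightarrow> real^('n1 + 'n2)^('n1 + 'n2)" where
  "block_diag A D = (\<chi> i j. case (i, j) of
       (Inl a, Inl a') \<Rightarrow> A $ a $ a'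
     | (Inr b, Inr b') \<Rightarrow> D $ b $ b'
     | _ \<Rightarrow> 0)"

definition skew_symmetric :: "real^'n^'n \<Rightarrow> bool" where
  "skew_symmetric A \<longleftrightarrow> A = - transpose A"

definition sym_pos_semidef :: "real^'n^'n \<Rightarrow> bool" where
  "sym_pos_semidef A \<longleftrightarrow> A = transpose A \<and> (\<forall>v. 0 \<le> v \<bullet> (A *v v))"

definition C1_on :: "'a::euclidean_space set \<Rightarrow> ('a \<Rightarrow> real) \<Rightarrow> bool" where
  "C1_on S f \<longleftrightarrow> (\<exists>g. continuous_on S g \<and> (\<forall>x\<in>S. GDERIV f x :> g x))"

locale semi_explicit_pHDAE =
  fixes X1 :: "(real^'n1) set" and X2 :: "(real^'n2) set"
    and E :: "(real^'n1) \<times> (real^'n2) \<Rightarrow> real^('n1 + 'n2)^('n1 + 'n2)"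
    and E11 :: "(real^'n1) \<times> (real^'n2) \<Rightarrow> real^'n1^'n1"
    and J R :: "(real^'n1) \<times> (real^'n2) \<Rightarrow> real^('n1 + 'n2)^('n1 + 'n2)"
    and B :: "(real^'n1) \<times> (real^'n2) \<Rightarrow> real^'m^('n1 + 'n2)"
    and z :: "(real^'n1) \<times> (real^'n2) \<Rightarrow> (real^'n1) \<times> (real^'n2)"
    and H :: "(real^'n1) \<times> (real^'n2) \<Rightarrow> real"
  assumes open_X1: "open X1"
    and open_X2: "open X2" and convex_X2: "convex X2"
    and cont_E: "continuous_on (X1 \<times> X2) E"
    and cont_E11: "continuous_on (X1 \<times> X2) E11"
    and cont_J: "continuous_on (X1 \<times> X2) J"
    and cont_R: "continuous_on (X1 \<times> X2) R"
    and cont_B: "continuous_on (X1 \<times> X2) B"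
    and cont_z: "continuous_on (X1 \<times> X2) z"
    and J_skew: "x \<in> X1 \<times> X2 \<Longrightarrow> skew_symmetric (J x)"
    and R_psd: "x \<in> X1 \<times> X2 \<Longrightarrow> sym_pos_semidef (R x)"
    and E_block: "x \<in> X1 \<times> X2 \<Longrightarrow> E x = block_diag (E11 x) 0"
    and E11_invertible: "x \<in> X1 \<times> X2 \<Longrightarrow> invertible (E11 x)"
    and C1_H: "C1_on (X1 \<times> X2) H"
    and grad_H: "x \<in> X1 \<times> X2 \<Longrightarrow> GDERIV H x :> unstack (transpose (E x) *v stack (z x))"

text \<open>The Hamiltonian of a semi-explicit pHDAE does not depend on \<open>x\<^sub>2\<close>; the specified
  Hamiltonian is the resulting function of \<open>x\<^sub>1\<close> alone. It always exists, see
  \<open>specified_hamiltonian_exists\<close> below.\<close>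

definition specified_hamiltonian ::
  "(real^'n1) set \<Rightarrow> (real^'n2) set \<Rightarrow> ((real^'n1) \<times> (real^'n2) \<Rightarrow> real^'n1^'n1)
    \<Rightarrow> ((real^'n1) \<times> (real^'n2) \<Rightarrow> (real^'n1) \<times> (real^'n2))
    \<Rightarrow> ((real^'n1) \<times> (real^'n2) \<Rightarrow> real) \<Rightarrow> (real^'n1 \<Rightarrow> real) \<Rightarrow> bool" where
  "specified_hamiltonian X1 X2 E11 z H H1 \<longleftrightarrow>
     C1_on X1 H1 \<and>
     (\<forall>x1\<in>X1. \<forall>x2\<in>X2. H1 x1 = H (x1, x2) \<and>
        GDERIV H1 x1 :> transpose (E11 (x1, x2)) *v fst (z (x1, x2)))"

definition discrete_gradient ::
  "'a::euclidean_space set \<Rightarrow> ('a \<Rightarrow> real) \<Rightarrow> ('a \<Rightarrow> 'a \<Rightarrow> 'a) \<Rightarrow> bool" where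
  "discrete_gradient Y f Df \<longleftrightarrow>
     continuous_on (Y \<times> Y) (\<lambda>(x, x'). Df x x') \<and>
     (\<forall>x\<in>Y. \<forall>x'\<in>Y. Df x x' \<bullet> (x' - x) = f x' - f x) \<and>
     (\<forall>x\<in>Y. GDERIV f x :> Df x x)"

definition consistent_approximation ::
  "'a::topological_space set \<Rightarrow> ('a \<Rightarrow> 'b::topological_space) \<Rightarrow> ('a \<Rightarrow> 'a \<Rightarrow> 'b) \<Rightarrow> bool" where
  "consistent_approximation X F Fbar \<longleftrightarrow>
     continuous_on (X \<times> X) (\<lambda>(x, x'). Fbar x x') \<and> (\<forall>x\<in>X. Fbar x x = F x)"

lemma unstack_transpose_block_diag:
  "unstack (transpose (block_diag A 0) *v stack p) = (transpose A *v fst p, 0)"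
  by (simp add: unstack_def stack_def block_diag_def transpose_def matrix_vector_mult_def
      prod_eq_iff vec_eq_iff UNIV_Plus_UNIV[symmetric] sum.Plus del: UNIV_Plus_UNIV)

context semi_explicit_pHDAE
begin

lemma grad_H_block:
  assumes "x1 \<in> X1" "x2 \<in> X2"
  shows "(H has_derivative (\<lambda>p. fst p \<bullet> (transpose (E11 (x1, x2)) *v fst (z (x1, x2)))))
           (at (x1, x2))"
  using grad_H[of "(x1, x2)"] assms
  by (simp add: gderiv_def E_block unstack_transpose_block_diag inner_prod_def
      del: transpose_matrix_vector)

lemma H_indep_x2:
  assumes "x1 \<in> X1" "x2 \<in> X2" "x2' \<in> X2"
  shows "H (x1, x2) = H (x1, x2')"
proof -
  have "((\<lambda>v. H (x1, v)) has_derivative (\<lambda>h. 0)) (at v within X2)" if "v \<in> X2" for v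
  proof -
    have "((\<lambda>v. (x1, v)) has_derivative (\<lambda>h. (0, h))) (at v within X2)"
      by (intro derivative_intros)
    from has_derivative_compose[OF this grad_H_block[OF assms(1) that]]
    show ?thesis by simp
  qed
  then obtain c where "\<And>v. v \<in> X2 \<Longrightarrow> H (x1, v) = c"
    using has_derivative_zero_constant[OF convex_X2, of "\<lambda>v. H (x1, v)"] by blast
  then show ?thesis using assms by simp
qed

lemma specified_hamiltonian_exists: "\<exists>H1. specified_hamiltonian X1 X2 E11 z H H1"
proof (cases "X2 = {}")
  case True
  have "C1_on X1 (\<lambda>_. 0)"
    unfolding C1_on_def gderiv_def by (rule exI[of _ "\<lambda>_. 0"]) simp
  then show ?thesis using True by (auto simp: specified_hamiltonian_def)
next
  case False
  then obtain c where c: "c \<in> X2" by blast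
  define H1 where "H1 = (\<lambda>v. H (v, c))"
  have val: "H1 x1 = H (x1, x2)" if "x1 \<in> X1" "x2 \<in> X2" for x1 x2
    using H_indep_x2[OF that(1) c that(2)] by (simp add: H1_def)
  have grad: "GDERIV H1 x1 :> transpose (E11 (x1, x2)) *v fst (z (x1, x2))"
    if "x1 \<in> X1" "x2 \<in> X2" for x1 x2
  proof -
    have "((\<lambda>v. (v, x2)) has_derivative (\<lambda>h. (h, 0))) (at x1)"
      by (intro derivative_intros)
    from has_derivative_compose[OF this grad_H_block[OF that]]
    have "((\<lambda>v. H (v, x2)) has_derivative
            (\<lambda>h. h \<bullet> (transpose (E11 (x1, x2)) *v fst (z (x1, x2))))) (at x1)"
      by simp
    then show ?thesis
      unfolding gderiv_def
      by (rule has_derivative_transform_within_open[OF _ open_X1 that(1)])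
        (simp add: val[OF _ that(2), symmetric])
  qed
  have incl: "continuous_on X1 (\<lambda>v. (v, c))" "(\<lambda>v. (v, c)) ` X1 \<subseteq> X1 \<times> X2"
    using c by (auto intro!: continuous_intros)
  have cE: "continuous_on X1 (\<lambda>v. E11 (v, c))"
    by (rule continuous_on_compose2[OF cont_E11 incl])
  have cz: "continuous_on X1 (\<lambda>v. z (v, c))"
    by (rule continuous_on_compose2[OF cont_z incl])
  have "continuous_on X1 (\<lambda>v. transpose (E11 (v, c)) *v fst (z (v, c)))"
    unfolding matrix_vector_mult_def transpose_def
    by (simp, intro continuous_intros continuous_on_vec_lambda cE cz)
  then have "C1_on X1 H1"
    using grad c unfolding C1_on_def by blast
  then show ?thesis
    using val grad unfolding specified_hamiltonian_def by blast
qed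

end

end

theory Submission
  imports Defs
begin

text \<open>Testing the scheme with \<open>\<zeta>\<close> turns its left-hand side into the increment of \<open>H1\<close>, by the
  discrete gradient property, and hence of \<open>H\<close>; on the right-hand side the skew-symmetric part
  drops out, leaving dissipation and supplied energy.\<close>

text \<open>The zero block annihilates the second component of \<open>q\<close>, so only first
  components meet. Moving \<open>A\<close> to the left factor as its transpose matches the form of
  \<open>z1_eq\<close>, where a discrete gradient can be substituted.\<close>

lemma inner_block_diag_stack:
  "stack p \<bullet> (block_diag A 0 *v stack q) = (transpose A *v fst p) \<bullet> fst q"
proof -
  have "stack p \<bullet> (block_diag A 0 *v stack q) = fst p \<bullet> (A *v fst q)"
    by (simp add: stack_def block_diag_def matrix_vector_mult_def inner_vec_def
        UNIV_Plus_UNIV[symmetric] sum.Plus del: UNIV_Plus_UNIV)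
  then show ?thesis by (simp add: dot_lmul_matrix)
qed

text \<open>Passing \<open>A\<close> across the inner product turns it into its transpose
  \<open>- A\<close>, so the quadratic form equals its own negative.\<close>

lemma skew_symmetric_inner_eq_0:
  assumes "skew_symmetric A"
  shows "v \<bullet> (A *v v) = 0"
proof -
  have "v \<bullet> (A *v v) = (transpose A *v v) \<bullet> v"
    by (simp add: dot_lmul_matrix)
  also have "transpose A = - A"
    using assms unfolding skew_symmetric_def by (metis minus_minus)
  \<comment> \<open>The matrix \<open>- A\<close> is read as \<open>0 - A\<close>, so that
    distributivity over a difference yields the sign.\<close>
  also have "(- A *v v) \<bullet> v = - (v \<bullet> (A *v v))"
    using matrix_vector_mult_diff_rdistrib[of 0 A v] by (simp add: inner_commute)
  finally show ?thesis by simp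
qed

theorem theorem4p2:
  fixes X1 :: "(real^'n1) set" and X2 :: "(real^'n2) set"
    and E :: "(real^'n1) \<times> (real^'n2) \<Rightarrow> real^('n1 + 'n2)^('n1 + 'n2)"
    and E11 :: "(real^'n1) \<times> (real^'n2) \<Rightarrow> real^'n1^'n1"
    and J R :: "(real^'n1) \<times> (real^'n2) \<Rightarrow> real^('n1 + 'n2)^('n1 + 'n2)"
    and B :: "(real^'n1) \<times> (real^'n2) \<Rightarrow> real^'m^('n1 + 'n2)"
    and z :: "(real^'n1) \<times> (real^'n2) \<Rightarrow> (real^'n1) \<times> (real^'n2)"
    and H :: "(real^'n1) \<times> (real^'n2) \<Rightarrow> real"
    and H1 :: "real^'n1 \<Rightarrow> real"
    and DH1 :: "real^'n1 \<Rightarrow> real^'n1 \<Rightarrow> real^'n1"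
    and E11bar :: "(real^'n1) \<times> (real^'n2) \<Rightarrow> (real^'n1) \<times> (real^'n2) \<Rightarrow> real^'n1^'n1"
    and z2bar :: "(real^'n1) \<times> (real^'n2) \<Rightarrow> (real^'n1) \<times> (real^'n2) \<Rightarrow> real^'n2"
    and Jbar Rbar :: "(real^'n1) \<times> (real^'n2) \<Rightarrow> (real^'n1) \<times> (real^'n2)
                        \<Rightarrow> real^('n1 + 'n2)^('n1 + 'n2)"
    and Bbar :: "(real^'n1) \<times> (real^'n2) \<Rightarrow> (real^'n1) \<times> (real^'n2)
                   \<Rightarrow> real^'m^('n1 + 'n2)"
    and h :: real
    and x x' :: "(real^'n1) \<times> (real^'n2)"
    and z1 :: "real^'n1"
    and u y :: "real^'m"
    and \<zeta> :: "real^('n1 + 'n2)"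
  assumes pHDAE: "semi_explicit_pHDAE X1 X2 E E11 J R B z H"
    and spec: "specified_hamiltonian X1 X2 E11 z H H1"
    and dgrad: "discrete_gradient X1 H1 DH1"
    and approx_E11: "consistent_approximation (X1 \<times> X2) E11 E11bar"
    and approx_z2: "consistent_approximation (X1 \<times> X2) (\<lambda>p. snd (z p)) z2bar"
    and approx_J: "consistent_approximation (X1 \<times> X2) J Jbar"
    and approx_R: "consistent_approximation (X1 \<times> X2) R Rbar"
    and approx_B: "consistent_approximation (X1 \<times> X2) B Bbar"
    and Jbar_skew: "\<forall>p\<in>X1 \<times> X2. \<forall>p'\<in>X1 \<times> X2. skew_symmetric (Jbar p p')"
    and Rbar_psd: "\<forall>p\<in>X1 \<times> X2. \<forall>p'\<in>X1 \<times> X2. sym_pos_semidef (Rbar p p')"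
    and h_pos: "h > 0"
    and x_in: "x \<in> X1 \<times> X2" and x'_in: "x' \<in> X1 \<times> X2"
    and \<zeta>_eq: "\<zeta> = stack (z1, z2bar x x')"
    and step: "block_diag (E11bar x x') 0 *v stack (x' - x)
                 = h *\<^sub>R ((Jbar x x' - Rbar x x') *v \<zeta>) + h *\<^sub>R (Bbar x x' *v u)"
    and y_eq: "y = transpose (Bbar x x') *v \<zeta>"
    and z1_eq: "transpose (E11bar x x') *v z1 = DH1 (fst x) (fst x')"
  shows "H x' - H x = - h * (\<zeta> \<bullet> (Rbar x x' *v \<zeta>)) + h * (y \<bullet> u) \<and>
         - h * (\<zeta> \<bullet> (Rbar x x' *v \<zeta>)) + h * (y \<bullet> u) \<le> h * (y \<bullet> u)"
proof -
  \<comment> \<open>Each endpoint is used with its own second component, so a jump in that component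
    does not change the energy.\<close>
  have Heq: "H1 (fst x) = H x" "H1 (fst x') = H x'"
    using spec x_in x'_in unfolding specified_hamiltonian_def
    by (metis mem_Times_iff prod.collapse)+
  have skew: "\<zeta> \<bullet> (Jbar x x' *v \<zeta>) = 0"
    using Jbar_skew x_in x'_in by (blast intro: skew_symmetric_inner_eq_0)
  have port: "\<zeta> \<bullet> (Bbar x x' *v u) = y \<bullet> u"
    by (simp add: y_eq dot_lmul_matrix)
  \<comment> \<open>The discrete gradient replaces the chain rule: it is exact for finite
    increments, so no error term in \<open>h\<close> appears.\<close>
  have "H x' - H x = DH1 (fst x) (fst x') \<bullet> (fst x' - fst x)"
    using dgrad x_in x'_in Heq unfolding discrete_gradient_def by auto
  also have "\<dots> = \<zeta> \<bullet> (block_diag (E11bar x x') 0 *v stack (x' - x))"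
    unfolding \<zeta>_eq inner_block_diag_stack using z1_eq by simp
  also have "\<dots> = - h * (\<zeta> \<bullet> (Rbar x x' *v \<zeta>)) + h * (y \<bullet> u)"
    unfolding step
    by (simp add: inner_add_right inner_diff_right matrix_vector_mult_diff_rdistrib skew port)
  finally have balance: "H x' - H x = - h * (\<zeta> \<bullet> (Rbar x x' *v \<zeta>)) + h * (y \<bullet> u)" .
  \<comment> \<open>Scaled by \<open>h > 0\<close>, this is the dissipated energy; dropping it from
    the balance gives the inequality.\<close>
  have "0 \<le> \<zeta> \<bullet> (Rbar x x' *v \<zeta>)"
    using Rbar_psd x_in x'_in unfolding sym_pos_semidef_def by blast
  with h_pos balance show ?thesis by simp
qed

end
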